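(* Let $(\mathcal M,d)$ be a projective-metric space of parabolic type (so $\mathcal M=\mathbb R^n$ for some $n\in\mathbb N$). The set of the centers of $(\mathcal M,d)$ contains a non-empty open set if and only if $(\mathcal M,d)$ is a Minkowski geometry.
   Context: A projective-metric space of parabolic type of dimension $n\in\mathbb N$ is a metric space $(\mathcal M,d)$ with $\mathcal M=\mathbb R^n$ such that $d$ is complete, continuous with respect to the standard topology, the geodesic lines of $d$ are exactly the straight lines of $\mathbb R^n$, and the geodesic lines of $d$ are isometric with a Euclidean straight line. A metric point reflection at $O\in\mathcal M$ is a non-identical involutive $d$-isometry of $\mathcal M$ onto $\mathcal M$ that fixes $O$ and maps every geodesic line passing through $O$ onto itself. A point $O\in\mathcal M$ is a center of $(\mathcal M,d)$ if there exists a metric point reflection at $O$. A Minkowski (Minkowskian) geometry is a space $(\mathbb R^n,d_{\mathcal I})$, where $\mathcal I\subset\mathbb R^n$ is an open, strictly convex, bounded domain that is centrally symmetric with respect to the origin, and $d_{\mathcal I}(x,y)=\inf\{\lambda>0:(y-x)/\lambda\in\mathcal I\}$.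
   Formalization: For n = 1, "is a Minkowski geometry" is read as "is isometric to a Minkowski geometry", since d(x,y) = |x³ − y³| on R has every point as a center but is not of the form d_I; for n ≥ 2 the literal equivalence with d = d_I is proved. *)

theory Defs
  imports "HOL-Analysis.Analysis"
begin

definition straight_line :: "'a::euclidean_space set \<Rightarrow> bool" where
  "straight_line L \<longleftrightarrow> affine L \<and> aff_dim L = 1"

definition isometry_between ::
    "'a set \<Rightarrow> ('a \<Rightarrow> 'a \<Rightarrow> real) \<Rightarrow> 'b set \<Rightarrow> ('b \<Rightarrow> 'b \<Rightarrow> real) \<Rightarrow> ('a \<Rightarrow> 'b) \<Rightarrow> bool" where
  "isometry_between S d T e f \<longleftrightarrow>
     bij_betw f S T \<and> (\<forall>x\<in>S. \<forall>y\<in>S. e (f x) (f y) = d x y)"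

(* Geodesic lines in Busemann's sense: images of the real line under locally isometric maps.
   That they are globally isometric to the real line is a separate requirement in the
   definition of parabolic type below. *)
definition geodesic_line :: "('a \<Rightarrow> 'a \<Rightarrow> real) \<Rightarrow> 'a set \<Rightarrow> bool" where
  "geodesic_line d L \<longleftrightarrow>
     (\<exists>\<gamma> :: real \<Rightarrow> 'a.
        (\<forall>t. \<exists>\<epsilon>>0. \<forall>r\<in>{t-\<epsilon>..t+\<epsilon>}. \<forall>s\<in>{t-\<epsilon>..t+\<epsilon>}. d (\<gamma> r) (\<gamma> s) = \<bar>r - s\<bar>)
        \<and> L = range \<gamma>)"

(* The carrier is the whole type; its dimension is at least 1, as it is for every
   Euclidean space type. The topology in the continuity clause is the standard one,
   while completeness refers to d itself. *)
definition projective_metric_parabolic :: "('a::euclidean_space \<Rightarrow> 'a \<Rightarrow> real) \<Rightarrow> bool" where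
  "projective_metric_parabolic d \<longleftrightarrow>
     Metric_space UNIV d
     \<and> Metric_space.mcomplete UNIV d
     \<and> continuous_on UNIV (\<lambda>(x, y). d x y)
     \<and> {L. geodesic_line d L} = {L. straight_line L}
     \<and> (\<forall>L. geodesic_line d L \<longrightarrow> (\<exists>\<gamma>. isometry_between (UNIV :: real set) dist L d \<gamma>))"

definition metric_point_reflection ::
    "('a \<Rightarrow> 'a \<Rightarrow> real) \<Rightarrow> 'a \<Rightarrow> ('a \<Rightarrow> 'a) \<Rightarrow> bool" where
  "metric_point_reflection d p \<rho> \<longleftrightarrow>
     isometry_between UNIV d UNIV d \<rho> \<and> \<rho> \<noteq> id \<and> \<rho> \<circ> \<rho> = id \<and> \<rho> p = p
     \<and> (\<forall>L. geodesic_line d L \<and> p \<in> L \<longrightarrow> \<rho> ` L = L)"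

definition centers :: "('a \<Rightarrow> 'a \<Rightarrow> real) \<Rightarrow> 'a set" where
  "centers d = {p. \<exists>\<rho>. metric_point_reflection d p \<rho>}"

(* For open S: the closure of S is convex and the boundary of S contains no
   non-degenerate segment; convexity of an open S itself is included. *)
definition strictly_convex :: "'a::euclidean_space set \<Rightarrow> bool" where
  "strictly_convex S \<longleftrightarrow>
     (\<forall>x\<in>closure S. \<forall>y\<in>closure S. x \<noteq> y \<longrightarrow> open_segment x y \<subseteq> interior S)"

definition minkowski_indicatrix :: "'a::euclidean_space set \<Rightarrow> bool" where
  "minkowski_indicatrix I \<longleftrightarrow>
     open I \<and> I \<noteq> {} \<and> connected I \<and> strictly_convex I \<and> bounded I \<and> (\<forall>x\<in>I. - x \<in> I)"

definition minkowski_dist :: "'a::euclidean_space set \<Rightarrow> 'a \<Rightarrow> 'a \<Rightarrow> real" where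
  "minkowski_dist I x y = Inf {l. l > 0 \<and> (y - x) /\<^sub>R l \<in> I}"

definition minkowski_metric :: "('a::euclidean_space \<Rightarrow> 'a \<Rightarrow> real) \<Rightarrow> bool" where
  "minkowski_metric d \<longleftrightarrow> (\<exists>I. minkowski_indicatrix I \<and> d = minkowski_dist I)"

(* Being a Minkowski geometry as a property of the metric space, i.e. up to isometry onto
   a Minkowski geometry of the same dimension. Among the metrics of parabolic type
   this differs from minkowski_metric only in dimension 1: there every parabolic metric has the
   form d x y = |f x - f y| with f a homeomorphism of the line (say f x = x^3), so that it is
   isometric to the Euclidean line and all points are centers, but d is minkowski_metric only
   if f is affine. *)
definition minkowski_geometry :: "('a::euclidean_space \<Rightarrow> 'a \<Rightarrow> real) \<Rightarrow> bool" where
  "minkowski_geometry d \<longleftrightarrow>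
     (\<exists>e \<phi>. minkowski_metric (e :: 'a \<Rightarrow> 'a \<Rightarrow> real) \<and> isometry_between UNIV d UNIV e \<phi>)"

end

(* In dimension at least 2, a metric point reflection at p permutes the straight lines and
   preserves those through p; as a line missing p goes to a parallel one, it is a homothety
   with center p, and being a non-trivial involution it is x \<mapsto> 2p - x. The products
   of two such reflections with centers in an open set are all the small translations, so d is
   translation invariant. Additivity of d along lines makes d 0 a norm, and strict convexity
   of its unit ball holds because a broken segment realizing equality in the triangle
   inequality would be part of a geodesic line that is not straight. Conversely, strict
   convexity makes isometrically parametrized lines of a Minkowski geometry affine, so the
   affine reflections, transported by the given isometry, are metric point reflections.
   In dimension 1 the whole space is a geodesic line. *)
theory Submission
  imports Defs
begin

section \<open>Parametrized straight lines\<close>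

lemma straight_line_iff:
  fixes L :: "'a::euclidean_space set"
  shows "straight_line L \<longleftrightarrow> (\<exists>x v. v \<noteq> 0 \<and> L = range (\<lambda>t. x + t *\<^sub>R v))"
proof
  assume L: "straight_line L"
  then have "affine L" "aff_dim L = 1" by (auto simp: straight_line_def)
  obtain B where B: "affine hull B = L" "\<not> affine_dependent B" "of_nat (card B) = aff_dim L + 1"
    using aff_dim_basis_exists[of L] \<open>affine L\<close> by (metis hull_same)
  then have "card B = 2" using \<open>aff_dim L = 1\<close> by simp
  then obtain a b where "B = {a, b}" "a \<noteq> b" by (auto simp: card_2_iff)
  then have "L = range (\<lambda>t. a + t *\<^sub>R (b - a))" using B(1) affine_hull_2_alt[of a b] by simp
  then show "\<exists>x v. v \<noteq> 0 \<and> L = range (\<lambda>t. x + t *\<^sub>R v)"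
    using \<open>a \<noteq> b\<close> by (intro exI[of _ a] exI[of _ "b - a"]) auto
next
  assume "\<exists>x v. v \<noteq> 0 \<and> L = range (\<lambda>t. x + t *\<^sub>R v)"
  then obtain x v where v: "v \<noteq> 0" "L = range (\<lambda>t. x + t *\<^sub>R v)" by auto
  then have "L = affine hull {x, x + v}" using affine_hull_2_alt[of x "x + v"] by simp
  then show "straight_line L" using v(1) by (simp add: straight_line_def aff_dim_2)
qed

section \<open>The distance defined by an indicatrix, and equality in its triangle
  inequality\<close>

lemma minkowski_dist_translate: "minkowski_dist I x y = minkowski_dist I 0 (y - x)"
  by (simp add: minkowski_dist_def)

lemma minkowski_dist_uminus:
  assumes "minkowski_indicatrix I"
  shows "minkowski_dist I 0 (- z) = minkowski_dist I 0 z"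
proof -
  have "- x \<in> I \<longleftrightarrow> x \<in> I" for x using assms unfolding minkowski_indicatrix_def
    by (metis minus_minus)
  then show ?thesis by (simp add: minkowski_dist_def)
qed

lemma minkowski_dist_reflect:
  assumes "minkowski_indicatrix I"
  shows "minkowski_dist I (2 *\<^sub>R p - x) (2 *\<^sub>R p - y) = minkowski_dist I x y"
proof -
  have "minkowski_dist I (2 *\<^sub>R p - x) (2 *\<^sub>R p - y) = minkowski_dist I 0 (- (y - x))"
    by (subst minkowski_dist_translate) simp
  then show ?thesis using minkowski_dist_uminus[OF assms] minkowski_dist_translate by metis
qed

text \<open>The origin is the midpoint of x and -x for any x in \<open>I\<close>, and strict
  convexity puts the open segment between them into the interior.\<close>

lemma indicatrix_zero:
  assumes "minkowski_indicatrix I"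
  shows "0 \<in> I"
proof -
  obtain x where x: "x \<in> I" "- x \<in> I" using assms unfolding minkowski_indicatrix_def by blast
  show ?thesis
  proof (cases "x = 0")
    case False
    have "x \<noteq> - x"
    proof
      assume "x = - x"
      then have "2 *\<^sub>R x = 0" by (simp add: scaleR_2 eq_neg_iff_add_eq_0)
      then show False using False by simp
    qed
    then have "open_segment x (- x) \<subseteq> interior I"
      using assms x closure_subset unfolding minkowski_indicatrix_def strictly_convex_def by blast
    moreover have "0 \<in> open_segment x (- x)"
      using \<open>x \<noteq> - x\<close> unfolding in_segment by (auto intro!: exI[of _ "1/2"])
    ultimately show ?thesis using interior_subset by blast
  qed (use x in simp)
qed

text \<open>As \<open>I\<close> is open, w / t stays in \<open>I\<close> for t slightly below l, and
  the infimum is at most such a t.\<close>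

lemma minkowski_dist_less:
  assumes I: "minkowski_indicatrix I" and l: "l > 0" "w /\<^sub>R l \<in> I"
  shows "minkowski_dist I 0 w < l"
proof -
  have "open I" using I by (simp add: minkowski_indicatrix_def)
  have "((\<lambda>t. w /\<^sub>R t) \<longlongrightarrow> w /\<^sub>R l) (at_left l)"
    using l(1) by (intro tendsto_intros) auto
  then have "\<forall>\<^sub>F t in at_left l. w /\<^sub>R t \<in> I"
    using \<open>open I\<close> l(2) by (rule topological_tendstoD)
  moreover have "\<forall>\<^sub>F t in at_left l. t \<in> {0<..<l}"
    using l(1) by (rule eventually_at_left_real)
  ultimately have "\<forall>\<^sub>F t in at_left l. w /\<^sub>R t \<in> I \<and> t \<in> {0<..<l}"
    by (rule eventually_conj)
  then obtain t where t: "w /\<^sub>R t \<in> I" "0 < t" "t < l"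
    using eventually_happens[of _ "at_left l"] trivial_limit_at_left_real by fastforce
  have "minkowski_dist I 0 w \<le> t"
    unfolding minkowski_dist_def
    by (rule cInf_lower) (use t in \<open>auto intro!: bdd_belowI[of _ 0]\<close>)
  then show ?thesis using t by simp
qed

text \<open>A bound B on the norms in \<open>I\<close> keeps every admissible l above |z| / B. The
  infimum is a limit of admissible l, so z divided by it is a limit of points of
  \<open>I\<close>.\<close>

lemma minkowski_dist_pos:
  assumes I: "minkowski_indicatrix I" and z: "z \<noteq> 0"
  shows "minkowski_dist I 0 z > 0"
    and "z /\<^sub>R minkowski_dist I 0 z \<in> closure I"
proof -
  let ?S = "{l. l > 0 \<and> z /\<^sub>R l \<in> I}"
  define N where "N = Inf ?S"
  have N: "minkowski_dist I 0 z = N" by (simp add: minkowski_dist_def N_def)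
  have "open I" "bounded I" using I by (auto simp: minkowski_indicatrix_def)
  obtain e where e: "e > 0" "ball 0 e \<subseteq> I"
    using \<open>open I\<close> indicatrix_zero[OF I] openE by blast
  \<comment> \<open>This scale shrinks z to norm e / 2, inside the ball, so at least one l is
    admissible.\<close>
  have "z /\<^sub>R (2 * norm z / e) \<in> ball 0 e" using z e(1) by simp
  then have ne: "?S \<noteq> {}" using e z
    by (intro ex_in_conv[THEN iffD1] exI[of _ "2 * norm z / e"]) auto
  obtain B where B: "B > 0" "\<And>x. x \<in> I \<Longrightarrow> norm x \<le> B"
    using \<open>bounded I\<close> bounded_pos by blast
  have lower: "norm z / B \<le> l" if "l \<in> ?S" for l
    using B(2)[of "z /\<^sub>R l"] that B(1) by (simp add: field_simps)
  have "norm z / B \<le> N" unfolding N_def by (rule cInf_greatest[OF ne lower])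
  then have pos: "N > 0" using B(1) z by (meson divide_pos_pos less_le_trans zero_less_norm_iff)
  then show "minkowski_dist I 0 z > 0" using N by simp
  have bdd: "bdd_below ?S" by (intro bdd_belowI[of _ 0]) auto
  have "?S \<subseteq> {N..}" unfolding N_def using cInf_lower[OF _ bdd] by auto
  then have "closure ?S \<subseteq> {N..}" by (simp add: closure_minimal)
  then have "continuous_on (closure ?S) (\<lambda>l. z /\<^sub>R l)"
    using pos by (intro continuous_intros) auto
  then have "(\<lambda>l. z /\<^sub>R l) ` closure ?S \<subseteq> closure I"
    by (rule image_closure_subset) (use closure_subset in auto)
  moreover have "N \<in> closure ?S" unfolding N_def by (rule closure_contains_Inf[OF ne bdd])
  ultimately show "z /\<^sub>R minkowski_dist I 0 z \<in> closure I" using N by auto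
qed

text \<open>The point (u + v) / (a + b) is a proper convex combination of u / a and v / b, which lie
  in the closure of \<open>I\<close>. If they were distinct, strict convexity would put it into
  \<open>I\<close>, making the distance from 0 to u + v smaller than a + b.\<close>

lemma minkowski_dist_triangle_eq:
  assumes I: "minkowski_indicatrix I"
    and u: "minkowski_dist I 0 u = a" "u \<noteq> 0" and v: "minkowski_dist I 0 v = b" "v \<noteq> 0"
    and eq: "minkowski_dist I 0 (u + v) = a + b"
  shows "u /\<^sub>R a = v /\<^sub>R b"
proof (rule ccontr)
  assume ne: "u /\<^sub>R a \<noteq> v /\<^sub>R b"
  have pos: "a > 0" "b > 0" and cl: "u /\<^sub>R a \<in> closure I" "v /\<^sub>R b \<in> closure I"
    using minkowski_dist_pos[OF I] u v by auto
  have "open_segment (u /\<^sub>R a) (v /\<^sub>R b) \<subseteq> interior I"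
    using I cl ne unfolding minkowski_indicatrix_def strictly_convex_def by blast
  moreover have "(u + v) /\<^sub>R (a + b) \<in> open_segment (u /\<^sub>R a) (v /\<^sub>R b)"
  proof -
    have "1 - b / (a + b) = a / (a + b)" using pos by (simp add: field_simps)
    then have "(u + v) /\<^sub>R (a + b) = (1 - b / (a + b)) *\<^sub>R (u /\<^sub>R a) + (b / (a + b)) *\<^sub>R (v /\<^sub>R b)"
      using pos by (simp add: field_simps scaleR_add_right)
    then show ?thesis using ne pos unfolding in_segment
      by (intro conjI exI[of _ "b / (a + b)"]) auto
  qed
  ultimately have "(u + v) /\<^sub>R (a + b) \<in> I" using interior_subset by blast
  then show False using minkowski_dist_less[OF I, of "a + b" "u + v"] pos eq by simp
qed

text \<open>Two consecutive steps of parameter length h realize equality in the triangle inequality,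
  so they are the same vector. Hence the affine reflection at a point of an isometric curve reverses
  the parameter of the curve.\<close>

lemma minkowski_isometric_line_midpoint:
  assumes I: "minkowski_indicatrix I"
    and g: "\<And>r s :: real. minkowski_dist I (g r) (g s) = \<bar>r - s\<bar>"
  shows "2 *\<^sub>R g s - g t = g (2 * s - t)"
proof -
  have N: "minkowski_dist I 0 (g s - g r) = \<bar>r - s\<bar>" for r s
    using g minkowski_dist_translate by metis
  have "g s - g (s - h) = g (s + h) - g s" if "h > 0" for s h
  proof -
    have ne: "g r \<noteq> g s" if "r \<noteq> s" for r s
      using g[of r s] g[of s s] that by auto
    have "(g s - g (s - h)) /\<^sub>R h = (g (s + h) - g s) /\<^sub>R h"
      by (rule minkowski_dist_triangle_eq[OF I])
        (use that ne[of "s - h" s] ne[of s "s + h"] N in auto)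
    then show ?thesis using that by simp
  qed
  note mid = this
  consider "t < s" | "t = s" | "t > s" by linarith
  then show ?thesis
  proof cases
    case 1
    then show ?thesis using mid[of "s - t" s] by (simp add: scaleR_2 algebra_simps)
  next
    case 2
    then show ?thesis by (simp add: scaleR_2)
  next
    case 3
    then show ?thesis using mid[of "t - s" s] by (simp add: scaleR_2 algebra_simps)
  qed
qed

section \<open>All points of a Minkowski geometry are centers\<close>

lemma isometry_between_line:
  assumes "isometry_between (UNIV :: real set) dist L d g"
  shows "d (g r) (g s) = \<bar>r - s\<bar>" and "range g = L"
  using assms by (auto simp: isometry_between_def bij_betw_def dist_real_def)

lemma centers_minkowski:
  fixes d :: "'a::euclidean_space \<Rightarrow> 'a \<Rightarrow> real"
  assumes d: "projective_metric_parabolic d" and m: "minkowski_geometry d"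
  shows "centers d = UNIV"
proof -
  obtain I \<phi> where I: "minkowski_indicatrix (I :: 'a set)"
    and iso: "isometry_between UNIV d UNIV (minkowski_dist I) \<phi>"
    using m unfolding minkowski_geometry_def minkowski_metric_def by blast
  have bij: "bij \<phi>" and e: "minkowski_dist I (\<phi> x) (\<phi> y) = d x y" for x y
    using iso by (auto simp: isometry_between_def)
  have fi: "\<phi> (inv \<phi> x) = x" "inv \<phi> (\<phi> x) = x" for x
    using bij by (auto simp: bij_is_surj surj_f_inv_f bij_is_inj)
  have "metric_point_reflection d p (\<lambda>x. inv \<phi> (2 *\<^sub>R \<phi> p - \<phi> x))"
    (is "metric_point_reflection d p ?r") for p
  proof -
    have inv: "?r (?r x) = x" for x by (simp add: fi)
    have "bij ?r" by (rule involuntory_imp_bij) (rule inv)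
    moreover have "d (?r x) (?r y) = d x y" for x y
      by (simp add: e[symmetric] fi minkowski_dist_reflect[OF I])
    ultimately have "isometry_between UNIV d UNIV d ?r" by (simp add: isometry_between_def)
    moreover have "?r \<noteq> id"
    proof
      assume id: "?r = id"
      obtain b :: 'a where b: "b \<noteq> 0" using nonzero_Basis nonempty_Basis by blast
      have "?r (inv \<phi> (\<phi> p + b)) = inv \<phi> (\<phi> p + b)"
        using fun_cong[OF id, of "inv \<phi> (\<phi> p + b)"] by (simp only: id_apply)
      then have "2 *\<^sub>R \<phi> p - (\<phi> p + b) = \<phi> p + b" using fi by metis
      then have "2 *\<^sub>R b = 0" by (simp add: scaleR_2 algebra_simps)
      then show False using b by simp
    qed
    moreover have "?r ` L = L" if L: "geodesic_line d L" "p \<in> L" for L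
    proof -
      obtain g where "isometry_between (UNIV :: real set) dist L d g"
        using d L unfolding projective_metric_parabolic_def by blast
      note g = isometry_between_line[OF this]
      have closed: "?r x \<in> L" if "x \<in> L" for x
      proof -
        have "p \<in> range g" "x \<in> range g" using that L(2) g(2) by auto
        then obtain s t where "p = g s" "x = g t" by blast
        \<comment> \<open>The curve \<open>\<phi> \<circ> g\<close> is isometric for the Minkowski
          distance, so the affine reflection at \<open>\<phi> p\<close> reverses its parameter about
          s; thus \<open>?r\<close> sends \<open>g t\<close> to the point of L with parameter 2s -
          t.\<close>
        then have "?r x = inv \<phi> (\<phi> (g (2 * s - t)))"
          using minkowski_isometric_line_midpoint[OF I, of "\<phi> \<circ> g" s t] by (simp add: e g(1))
        then show ?thesis using g(2) fi by auto
      qed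
      show ?thesis
      proof
        show "?r ` L \<subseteq> L" using closed by blast
        show "L \<subseteq> ?r ` L"
        proof
          fix x assume "x \<in> L"
          then have "?r (?r x) \<in> ?r ` L" using closed by (intro imageI)
          then show "x \<in> ?r ` L" unfolding inv .
        qed
      qed
    qed
    ultimately show ?thesis unfolding metric_point_reflection_def
      using inv by (auto simp: fi scaleR_2 fun_eq_iff)
  qed
  then show ?thesis unfolding centers_def by auto
qed

section \<open>Minkowski geometries up to isometry, and the one-dimensional case\<close>

lemma minkowski_metric_imp_geometry:
  "minkowski_metric d \<Longrightarrow> minkowski_geometry d"
  unfolding minkowski_geometry_def
  by (rule exI[of _ d], rule exI[of _ id]) (simp add: isometry_between_def)

text \<open>Provides the model onto which the one-dimensional spaces are mapped. The unit ball is
  strictly convex because a point inside a segment is closer to the origin than one of the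
  endpoints.\<close>

lemma minkowski_metric_dist: "minkowski_metric (dist :: 'a::euclidean_space \<Rightarrow> 'a \<Rightarrow> real)"
proof -
  have "minkowski_indicatrix (ball 0 1 :: 'a set)"
  proof -
    have "open_segment x y \<subseteq> ball 0 1" if "x \<in> cball 0 1" "y \<in> cball 0 1" for x y :: 'a
      using open_segment_furthest_le[of _ x y "0 :: 'a"]
      by (smt (verit, best) dist_commute dist_decreases_open_segment mem_ball mem_cball subsetI that)
    then show ?thesis
      by (auto simp: minkowski_indicatrix_def strictly_convex_def)
  qed
  moreover have "dist x y = minkowski_dist (ball 0 1) x y" for x y :: 'a
  proof -
    have "norm ((y - x) /\<^sub>R l) < 1 \<longleftrightarrow> dist x y < l" if "l > 0" for l
    proof -
      have "norm ((y - x) /\<^sub>R l) = dist x y / l"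
        using that by (simp add: dist_norm norm_minus_commute divide_inverse mult.commute)
      then show ?thesis using that by simp
    qed
    then have "{l. l > 0 \<and> (y - x) /\<^sub>R l \<in> ball 0 1} = {dist x y<..}"
      by (auto simp del: norm_scaleR intro: le_less_trans[OF zero_le_dist])
    then show ?thesis by (simp add: minkowski_dist_def)
  qed
  ultimately show ?thesis unfolding minkowski_metric_def by blast
qed

text \<open>The whole space is a single geodesic line, so it has an isometric parameter
  \<open>inv g\<close>; laying this parameter off along a unit vector b gives an isometry onto the
  Euclidean metric.\<close>

lemma minkowski_geometry_dim_1:
  fixes d :: "'a::euclidean_space \<Rightarrow> 'a \<Rightarrow> real"
  assumes d: "projective_metric_parabolic d" and dim: "DIM('a) = 1"
  shows "minkowski_geometry d"
proof -
  have "straight_line (UNIV :: 'a set)" using dim by (simp add: straight_line_def)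
  then obtain g where iso: "isometry_between (UNIV :: real set) dist (UNIV :: 'a set) d g"
    using d unfolding projective_metric_parabolic_def by blast
  then have "bij g" by (simp add: isometry_between_def)
  obtain b :: 'a where b: "Basis = {b}" using dim by (auto simp: card_1_singleton_iff)
  then have nb: "norm b = 1" by (metis insertI1 norm_Basis)
  have eb: "(x \<bullet> b) *\<^sub>R b = x" for x
    using euclidean_representation[of x] unfolding b by simp
  have bb: "b \<bullet> b = 1" using nb by (simp add: norm_eq_1)
  have "bij (\<lambda>t. t *\<^sub>R b)"
    by (rule bij_betw_byWitness[where f' = "\<lambda>x. x \<bullet> b"]) (auto simp: bb eb)
  then have "bij ((\<lambda>t. t *\<^sub>R b) \<circ> inv g)"
    using \<open>bij g\<close> by (intro bij_comp bij_imp_bij_inv)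
  moreover have "dist (inv g x *\<^sub>R b) (inv g y *\<^sub>R b) = d x y" for x y
  proof -
    have "dist (inv g x *\<^sub>R b) (inv g y *\<^sub>R b) = \<bar>inv g x - inv g y\<bar>"
      using nb by (simp add: dist_norm scaleR_left_diff_distrib[symmetric])
    also have "\<dots> = d x y"
      using isometry_between_line(1)[OF iso, of "inv g x" "inv g y"] \<open>bij g\<close>
      by (simp add: bij_is_surj surj_f_inv_f)
    finally show ?thesis .
  qed
  ultimately have "isometry_between UNIV d UNIV dist ((\<lambda>t. t *\<^sub>R b) \<circ> inv g)"
    by (simp add: isometry_between_def)
  then show ?thesis using minkowski_metric_dist unfolding minkowski_geometry_def by blast
qed


section \<open>Collinearity and betweenness in parabolic metrics\<close>

lemma parabolic_metric:
  assumes "projective_metric_parabolic d"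
  shows "0 \<le> d x y" "d x y = d y x" "d x y = 0 \<longleftrightarrow> x = y" "d x z \<le> d x y + d y z"
proof -
  interpret Metric_space UNIV d using assms by (simp add: projective_metric_parabolic_def)
  show "0 \<le> d x y" "d x y = d y x" "d x y = 0 \<longleftrightarrow> x = y" "d x z \<le> d x y + d y z"
    by (simp_all add: commute triangle)
qed

lemma parabolic_geodesic_iff:
  assumes "projective_metric_parabolic d"
  shows "geodesic_line d L \<longleftrightarrow> straight_line L"
proof -
  have "{L. geodesic_line d L} = {L. straight_line L}"
    using assms by (simp add: projective_metric_parabolic_def)
  then show ?thesis by blast
qed

lemma parabolic_line_isometry:
  fixes d :: "'a::euclidean_space \<Rightarrow> 'a \<Rightarrow> real"
  assumes d: "projective_metric_parabolic d" and v: "v \<noteq> 0"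
  obtains g where "\<And>r s :: real. d (g r) (g s) = \<bar>r - s\<bar>" "range g = range (\<lambda>t. x + t *\<^sub>R v)"
proof -
  have "geodesic_line d (range (\<lambda>t. x + t *\<^sub>R v))"
    using parabolic_geodesic_iff[OF d] straight_line_iff v by blast
  then obtain g where g: "isometry_between (UNIV :: real set) dist (range (\<lambda>t. x + t *\<^sub>R v)) d g"
    using d unfolding projective_metric_parabolic_def by blast
  show ?thesis by (rule that[OF isometry_between_line[OF g]])
qed

lemma parabolic_line_through:
  fixes d :: "'a::euclidean_space \<Rightarrow> 'a \<Rightarrow> real"
  assumes d: "projective_metric_parabolic d" and pq: "p \<noteq> q"
  obtains g where "\<And>r s :: real. d (g r) (g s) = \<bar>r - s\<bar>" "g 0 = p" "g (d p q) = q"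
proof -
  obtain g where g: "\<And>r s :: real. d (g r) (g s) = \<bar>r - s\<bar>"
    and ran: "range g = range (\<lambda>t. p + t *\<^sub>R (q - p))"
    using parabolic_line_isometry[OF d, of "q - p"] pq by auto
  have "p + 0 *\<^sub>R (q - p) \<in> range g" "p + 1 *\<^sub>R (q - p) \<in> range g" unfolding ran by blast+
  then obtain r s where rs: "p = g r" "q = g s" by auto
  \<comment> \<open>The parameter is shifted to put p at 0, and reversed if q would otherwise get a
    negative parameter.\<close>
  show ?thesis
  proof (cases "r \<le> s")
    case True
    show ?thesis by (rule that[of "\<lambda>t. g (r + t)"]) (use True in \<open>simp_all add: g rs\<close>)
  next
    case False
    show ?thesis by (rule that[of "\<lambda>t. g (r - t)"]) (use False in \<open>simp_all add: g rs\<close>)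
  qed
qed

text \<open>Geodesic lines are defined by a local condition, so it is enough that the broken line
  a-b-c is isometric near its vertex b; its prolongations beyond a and c are isometric separately.
  It is therefore a geodesic line, hence straight.\<close>

lemma parabolic_triangle_eq_collinear:
  fixes d :: "'a::euclidean_space \<Rightarrow> 'a \<Rightarrow> real"
  assumes d: "projective_metric_parabolic d" and eq: "d a b + d b c = d a c"
    and ne: "a \<noteq> b" "b \<noteq> c"
  shows "collinear {a, b, c}"
proof -
  note m = parabolic_metric[OF d]
  obtain g where g: "\<And>r s :: real. d (g r) (g s) = \<bar>r - s\<bar>" "g 0 = b" "g (d b a) = a"
    using parabolic_line_through[OF d] ne(1) by metis
  obtain h where h: "\<And>r s :: real. d (h r) (h s) = \<bar>r - s\<bar>" "h 0 = b" "h (d b c) = c"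
    using parabolic_line_through[OF d] ne(2) by metis
  have pos: "d b a > 0" "d b c > 0" using m ne by (metis less_le)+
  \<comment> \<open>Equality for a, b, c passes to points on the two segments: if going from
    \<open>g r\<close> to \<open>h s\<close> were shorter than going through b, it would also
    shorten the way from a to c.\<close>
  have cross: "d (g r) (h s) = r + s" if "0 \<le> r" "r \<le> d b a" "0 \<le> s" "s \<le> d b c" for r s
  proof -
    have "d a (g r) = d b a - r" "d (h s) c = d b c - s" "d (g r) b = r" "d b (h s) = s"
      using g(1)[of "d b a" r] h(1)[of s "d b c"] g(1)[of r 0] h(1)[of 0 s] that g h by auto
    then show ?thesis
      using m(4)[of "g r" "h s" b] m(4)[of a c "g r"] m(4)[of "g r" c "h s"] eq m(2)[of a b]
      by linarith
  qed
  (* The broken line a-b-c, prolonged on both sides along its segments, is locally isometric. *)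
  define \<gamma> where "\<gamma> t = (if t \<le> 0 then g (- t) else h t)" for t
  have "\<exists>\<epsilon>>0. \<forall>r\<in>{t-\<epsilon>..t+\<epsilon>}. \<forall>s\<in>{t-\<epsilon>..t+\<epsilon>}. d (\<gamma> r) (\<gamma> s) = \<bar>r - s\<bar>" for t
  proof -
    consider "t < 0" | "t = 0" | "t > 0" by linarith
    then show ?thesis
    proof cases
      case 1
      then show ?thesis by (intro exI[of _ "- t / 2"]) (auto simp: \<gamma>_def g)
    next
      case 2
      have "d (\<gamma> r) (\<gamma> s) = \<bar>r - s\<bar>"
        if "\<bar>r\<bar> \<le> min (d b a) (d b c)" "\<bar>s\<bar> \<le> min (d b a) (d b c)" for r s
        using that cross[of "- r" s] cross[of "- s" r] m(2)[of "g (- s)" "h r"]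
        by (auto simp: \<gamma>_def g h)
      moreover have "min (d b a) (d b c) > 0" using pos by simp
      moreover have "\<bar>r\<bar> \<le> e \<longleftrightarrow> r \<in> {t - e..t + e}" for r e using 2 by auto
      ultimately show ?thesis by blast
    next
      case 3
      then show ?thesis by (intro exI[of _ "t / 2"]) (auto simp: \<gamma>_def h)
    qed
  qed
  then have "geodesic_line d (range \<gamma>)" unfolding geodesic_line_def by blast
  then have "aff_dim (range \<gamma>) = 1"
    using parabolic_geodesic_iff[OF d] by (simp add: straight_line_def)
  moreover have "\<gamma> (- d b a) = a" "\<gamma> 0 = b" "\<gamma> (d b c) = c"
    using pos by (auto simp: \<gamma>_def g h)
  then have "{a, b, c} \<subseteq> range \<gamma>" by (metis empty_subsetI insert_subset rangeI)
  ultimately show ?thesis using aff_dim_subset collinear_aff_dim by metis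
qed

lemma parabolic_continuous:
  fixes d :: "'a::euclidean_space \<Rightarrow> 'a \<Rightarrow> real"
  assumes "projective_metric_parabolic d"
  shows "continuous_on UNIV (d x)"
proof -
  have "continuous_on UNIV (\<lambda>(x, y). d x y)"
    using assms by (simp add: projective_metric_parabolic_def)
  then have "continuous_on UNIV (\<lambda>y. (\<lambda>(x, y). d x y) (x, y))"
    by (rule continuous_on_compose2) (auto intro!: continuous_intros)
  then show ?thesis by simp
qed

text \<open>On a straight line the isometric parameter is a continuous injective function of the
  affine one, hence monotone. So the metric order of points on a line is the affine order, and
  distances add up accordingly.\<close>

lemma parabolic_betweenness:
  fixes d :: "'a::euclidean_space \<Rightarrow> 'a \<Rightarrow> real"
  assumes d: "projective_metric_parabolic d" and st: "0 \<le> s" "s \<le> t"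
  shows "d x (x + t *\<^sub>R v) = d x (x + s *\<^sub>R v) + d (x + s *\<^sub>R v) (x + t *\<^sub>R v)"
proof -
  note m = parabolic_metric[OF d]
  show ?thesis
  proof (cases "v = 0 \<or> s = 0 \<or> s = t")
    case True
    have "d y y = 0" for y using m(3) by simp
    then show ?thesis using True by auto
  next
    case False
    then have v: "v \<noteq> 0" and s: "0 < s" "s < t" using st by auto
    obtain g where g: "\<And>r s :: real. d (g r) (g s) = \<bar>r - s\<bar>"
      and ran: "range g = range (\<lambda>t. x + t *\<^sub>R v)"
      using parabolic_line_isometry[OF d v, where x = x] by blast
    have "\<exists>r. g r = x + t *\<^sub>R v" for t using ran by (metis rangeE rangeI)
    then obtain f where f: "\<And>t. g (f t) = x + t *\<^sub>R v" by metis
    have df: "d (x + a *\<^sub>R v) (x + b *\<^sub>R v) = \<bar>f a - f b\<bar>" for a b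
      using g[of "f a" "f b"] by (simp add: f)
    have "inj f" using f v by (intro injI) (metis add_left_cancel scaleR_cancel_right)
    \<comment> \<open>Continuity of d in the standard topology makes |f a - f b| tend to 0 as b
      tends to a.\<close>
    have "isCont f a" for a
    proof -
      have "((\<lambda>b. d (x + a *\<^sub>R v) (x + b *\<^sub>R v)) \<longlongrightarrow> d (x + a *\<^sub>R v) (x + a *\<^sub>R v)) (at a)"
        by (rule continuous_on_tendsto_compose[OF parabolic_continuous[OF d]])
          (auto intro!: tendsto_intros)
      then have "((\<lambda>b. \<bar>f a - f b\<bar>) \<longlongrightarrow> 0) (at a)" by (simp add: df)
      then have "((\<lambda>b. f a - (f a - f b)) \<longlongrightarrow> f a - 0) (at a)"
        by (intro tendsto_diff tendsto_const) (simp add: tendsto_rabs_zero_iff)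
      then show ?thesis by (simp add: isCont_def)
    qed
    then have "continuous_on {0..t} f" by (simp add: continuous_at_imp_continuous_on)
    moreover have "inj_on f {0..t}" using \<open>inj f\<close> inj_on_subset by blast
    ultimately have "f 0 < f s \<and> f s < f t \<or> f t < f s \<and> f s < f 0"
      using continuous_inj_imp_mono[OF s] by auto
    then show ?thesis using df[of 0 t] df[of 0 s] df[of s t] by auto
  qed
qed

section \<open>Metric point reflections in dimension at least 2\<close>

lemma isometry_image_straight_line:
  fixes d :: "'a::euclidean_space \<Rightarrow> 'a \<Rightarrow> real"
  assumes d: "projective_metric_parabolic d" and iso: "\<And>x y. d (\<rho> x) (\<rho> y) = d x y"
    and L: "straight_line L"
  shows "straight_line (\<rho> ` L)"
proof -
  have "geodesic_line d L" using L parabolic_geodesic_iff[OF d] by simp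
  then obtain \<gamma> :: "real \<Rightarrow> 'a"
    where "\<forall>t. \<exists>\<epsilon>>0. \<forall>r\<in>{t-\<epsilon>..t+\<epsilon>}. \<forall>s\<in>{t-\<epsilon>..t+\<epsilon>}. d (\<gamma> r) (\<gamma> s) = \<bar>r - s\<bar>"
      and "L = range \<gamma>"
    unfolding geodesic_line_def by blast
  \<comment> \<open>Being a geodesic line is a condition on d alone, so it survives composition with
    an isometry.\<close>
  then have "geodesic_line d (\<rho> ` L)"
    unfolding geodesic_line_def by (intro exI[of _ "\<rho> \<circ> \<gamma>"]) (auto simp: iso image_comp)
  then show ?thesis using parabolic_geodesic_iff[OF d] by simp
qed

text \<open>Invariance of the lines through p yields a factor \<open>l u\<close> for each vector u.
  Independent vectors have equal factors, and dependent ones are compared through a third vector, so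
  there is one factor c. The involution forces c to be 1 or -1, and 1 would give the
  identity.\<close>

lemma metric_point_reflection_affine:
  fixes d :: "'a::euclidean_space \<Rightarrow> 'a \<Rightarrow> real"
  assumes d: "projective_metric_parabolic d" and dim: "DIM('a) \<ge> 2"
    and \<rho>: "metric_point_reflection d p \<rho>"
  shows "\<rho> x = 2 *\<^sub>R p - x"
proof -
  have "bij \<rho>" and iso: "\<And>x y. d (\<rho> x) (\<rho> y) = d x y" and nid: "\<rho> \<noteq> id"
    and "\<rho> \<circ> \<rho> = id" and fp: "\<rho> p = p"
    and lines: "\<And>L. straight_line L \<Longrightarrow> p \<in> L \<Longrightarrow> \<rho> ` L = L"
    using \<rho> parabolic_geodesic_iff[OF d]
    unfolding metric_point_reflection_def isometry_between_def by auto
  then have inv: "\<rho> (\<rho> x) = x" for x by (metis comp_apply id_apply)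
  have line0: "\<rho> ` range (\<lambda>t. p + t *\<^sub>R v) = range (\<lambda>t. p + t *\<^sub>R v)" if "v \<noteq> 0" for v
  proof (rule lines)
    have "p + 0 *\<^sub>R v \<in> range (\<lambda>t. p + t *\<^sub>R v)" by blast
    then show "p \<in> range (\<lambda>t. p + t *\<^sub>R v)" by simp
  qed (use that straight_line_iff in blast)
  have "\<exists>l. \<rho> (p + u) = p + l *\<^sub>R u" for u
  proof (cases "u = 0")
    case False
    have "p + 1 *\<^sub>R u \<in> range (\<lambda>t. p + t *\<^sub>R u)" by blast
    then have "\<rho> (p + u) \<in> \<rho> ` range (\<lambda>t. p + t *\<^sub>R u)" by simp
    then show ?thesis unfolding line0[OF False] by blast
  qed (simp add: fp)
  then obtain l where l: "\<And>u. \<rho> (p + u) = p + l u *\<^sub>R u" by metis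
  have indep: "l u = l v" if u: "u \<noteq> 0" and v: "v \<notin> span {u}" for u v
  proof (rule ccontr)
    assume ne: "l u \<noteq> l v"
    have uv: "v - u \<noteq> 0" using v span_base[of u "{u}"] by auto
    let ?L = "range (\<lambda>t. (p + u) + t *\<^sub>R (v - u))"
    (* If l u and l v differ, the image of the line through p + u and p + v meets the
       invariant parallel line through p, in the point z below. *)
    define t where "t = l u / (l u - l v)"
    define z where "z = (1 - t) *\<^sub>R \<rho> (p + u) + t *\<^sub>R \<rho> (p + v)"
    have "straight_line ?L" using uv straight_line_iff by blast
    then have "affine (\<rho> ` ?L)"
      using isometry_image_straight_line[OF d iso] straight_line_def by blast
    moreover have "p + u + 0 *\<^sub>R (v - u) \<in> ?L" "p + u + 1 *\<^sub>R (v - u) \<in> ?L" by blast+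
    then have "\<rho> (p + u) \<in> \<rho> ` ?L" "\<rho> (p + v) \<in> \<rho> ` ?L" by auto
    ultimately have "z \<in> \<rho> ` ?L" unfolding z_def by (intro mem_affine) auto
    then obtain a where a: "z = \<rho> (p + u + a *\<^sub>R (v - u))" by auto
    \<comment> \<open>This equation determines t: the coefficients of u and v in z - p become
      opposite, leaving a multiple of v - u.\<close>
    have "(1 - t) * l u = - (t * l v)" unfolding t_def using ne by (simp add: field_simps)
    moreover have "z = p + ((1 - t) * l u) *\<^sub>R u + (t * l v) *\<^sub>R v"
      unfolding z_def l by (simp add: algebra_simps)
    ultimately have "z = p + (t * l v) *\<^sub>R (v - u)"
      by (simp add: scaleR_diff_right)
    then have "z \<in> range (\<lambda>t. p + t *\<^sub>R (v - u))" by blast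
    then have "z \<in> \<rho> ` range (\<lambda>t. p + t *\<^sub>R (v - u))" unfolding line0[OF uv] .
    then obtain b where b: "z = \<rho> (p + b *\<^sub>R (v - u))" by auto
    \<comment> \<open>As \<open>\<rho>\<close> is injective, the two preimages of z agree. The
      parallel lines thus share a point, which makes u a multiple of v - u and contradicts
      independence.\<close>
    have "p + u + a *\<^sub>R (v - u) = p + b *\<^sub>R (v - u)" using a b inv by metis
    then have eq: "u = (b - a) *\<^sub>R (v - u)" by (simp add: algebra_simps)
    define k where "k = b - a"
    have "k \<noteq> 0" using eq u by (auto simp: k_def)
    have "k *\<^sub>R v = (1 + k) *\<^sub>R u" using eq unfolding k_def[symmetric] by (simp add: algebra_simps)
    then have "v = inverse k *\<^sub>R ((1 + k) *\<^sub>R u)"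
      using \<open>k \<noteq> 0\<close> by (metis left_inverse scaleR_one scaleR_scaleR)
    then show False using v by (metis span_base span_scale singletonI)
  qed
  have const: "l u = l v" if u: "u \<noteq> 0" and v: "v \<noteq> 0" for u v
  proof (cases "v \<in> span {u}")
    case True
    then obtain k where k: "v = k *\<^sub>R u" by (auto simp: span_singleton)
    \<comment> \<open>Dimension at least 2 supplies a vector w off the line spanned by u, and w is
      independent of both u and v.\<close>
    have "dim (span {u}) \<le> 1" using dim_le_card'[of "{u}"] by simp
    then have "span {u} \<noteq> UNIV" using dim by (auto simp del: dim_span)
    then obtain w where w: "w \<notin> span {u}" by auto
    have "span {v} \<subseteq> span {u}" using True by (simp add: span_minimal)
    then have "w \<notin> span {v}" using w by blast
    then show ?thesis using indep[OF u w] indep[OF v] by simp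
  qed (use indep u in simp)
  obtain b :: 'a where b: "b \<noteq> 0" using nonzero_Basis nonempty_Basis by blast
  define c where "c = l b"
  have c: "\<rho> (p + u) = p + c *\<^sub>R u" for u
    using l const[OF b] by (cases "u = 0") (auto simp: c_def fp)
  have "p + (c * c) *\<^sub>R b = p + 1 *\<^sub>R b" using inv[of "p + b"] by (simp add: c)
  then have "c * c = 1" using b by (metis add_left_cancel scaleR_cancel_right)
  moreover have "c \<noteq> 1"
  proof
    assume "c = 1"
    then have "\<rho> y = y" for y using c[of "y - p"] by simp
    then show False using nid by (auto simp: fun_eq_iff)
  qed
  ultimately have "c = - 1" by (simp add: square_eq_1_iff)
  then show ?thesis using c[of "x - p"] by (simp add: scaleR_2 algebra_simps)
qed

section \<open>Translation invariance and the resulting norm\<close>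

lemma translation_invariant_if_open_centers:
  fixes d :: "'a::euclidean_space \<Rightarrow> 'a \<Rightarrow> real"
  assumes d: "projective_metric_parabolic d" and dim: "DIM('a) \<ge> 2"
    and U: "open U" "U \<noteq> {}" "U \<subseteq> centers d"
  shows "d (x + w) (y + w) = d x y"
proof -
  have refl: "d (2 *\<^sub>R p - x) (2 *\<^sub>R p - y) = d x y" if p: "p \<in> U" for p x y
  proof -
    obtain \<rho> where \<rho>: "metric_point_reflection d p \<rho>" using p U(3) by (auto simp: centers_def)
    then have "d (\<rho> x) (\<rho> y) = d x y"
      by (simp add: metric_point_reflection_def isometry_between_def)
    then show ?thesis using metric_point_reflection_affine[OF d dim \<rho>] by simp
  qed
  obtain p where pU: "p \<in> U" using U(2) by blast
  obtain e where p: "e > 0" "ball p e \<subseteq> U" using U(1) pU by (rule openE)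
  have small: "d (x + w) (y + w) = d x y" if "norm w < e" for w x y
  proof -
    \<comment> \<open>Reflecting at p and then at q translates by 2 (q - p), so q has to be
      displaced from p by half of w.\<close>
    define q where "q = p + w /\<^sub>R 2"
    have "q \<in> U" using that p(1) by (intro subsetD[OF p(2)]) (simp add: q_def dist_norm)
    have eq: "2 *\<^sub>R q - (2 *\<^sub>R p - x) = x + w" for x
      by (simp add: q_def algebra_simps)
    show ?thesis
      using refl[OF \<open>q \<in> U\<close>, of "2 *\<^sub>R p - x" "2 *\<^sub>R p - y"]
      unfolding eq refl[OF pU] .
  qed
  \<comment> \<open>An arbitrary translation is cut into n equal steps, each shorter than e.\<close>
  obtain n :: nat where n: "norm w / e < of_nat n" using reals_Archimedean2 by blast
  have "norm w / e \<ge> 0" using p(1) by simp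
  then have n0: "n > 0" using n by (cases n) auto
  define v where "v = w /\<^sub>R n"
  have "norm v < e" using n n0 p(1) by (simp add: v_def field_simps)
  have "d (x + of_nat k *\<^sub>R v) (y + of_nat k *\<^sub>R v) = d x y" for k
  proof (induction k)
    case (Suc k)
    then show ?case
      using small[OF \<open>norm v < e\<close>, of "x + of_nat k *\<^sub>R v" "y + of_nat k *\<^sub>R v"]
      by (simp add: algebra_simps)
  qed simp
  from this[of n] show ?thesis using n0 by (simp add: v_def)
qed

text \<open>The distance from the origin, \<open>N\<close>, is a norm, and its open unit ball
  \<open>I\<close> is the indicatrix. Betweenness on lines gives homogeneity, and collinearity in
  the equality case of the triangle inequality gives strict convexity.\<close>

lemma minkowski_metric_if_translation_invariant:
  fixes d :: "'a::euclidean_space \<Rightarrow> 'a \<Rightarrow> real"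
  assumes d: "projective_metric_parabolic d" and trans: "\<And>x y w. d (x + w) (y + w) = d x y"
  shows "minkowski_metric d"
proof -
  note m = parabolic_metric[OF d]
  define N where "N = d 0"
  have N: "d x y = N (y - x)" for x y using trans[of x "- x" y] by (simp add: N_def)
  have cont: "continuous_on UNIV N" unfolding N_def by (rule parabolic_continuous[OF d])
  then have contS: "continuous_on S N" for S by (rule continuous_on_subset) simp
  have N0: "N z = 0 \<longleftrightarrow> z = 0" "N z \<ge> 0" for z using m(1,3) by (auto simp: N_def)
  have minus: "N (- z) = N z" for z using N[of z 0] m(2)[of z 0] N[of 0 z] by simp
  have tri: "N (u + v) \<le> N u + N v" for u v
    using m(4)[of 0 "u + v" u] by (simp add: N)
  have add: "N ((s + t) *\<^sub>R z) = N (s *\<^sub>R z) + N (t *\<^sub>R z)" if "0 \<le> s" "0 \<le> t" for s t z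
    using parabolic_betweenness[OF d, of s "s + t" 0 z] that by (simp add: N algebra_simps)
  have nat: "N (of_nat n *\<^sub>R z) = of_nat n * N z" for n z
  proof (induction n)
    case (Suc n)
    then show ?case using add[of "of_nat n" 1 z] by (simp add: algebra_simps)
  qed (simp add: N0)
  have rat: "N (t *\<^sub>R z) = \<bar>t\<bar> * N z" if t: "t \<in> \<rat>" for t z
  proof -
    obtain i k where ik: "k \<noteq> 0" "\<bar>t\<bar> = of_nat i / of_nat k"
      using Rats_abs_nat_div_natE[OF t] by metis
    have "of_nat k * N (\<bar>t\<bar> *\<^sub>R z) = N (of_nat i *\<^sub>R z)"
      unfolding nat[symmetric] using ik by simp
    then have "N (\<bar>t\<bar> *\<^sub>R z) = \<bar>t\<bar> * N z"
      using ik(1) by (simp add: nat ik(2) eq_divide_eq mult.commute)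
    then show ?thesis using minus[of "t *\<^sub>R z"] by (cases "t \<ge> 0") auto
  qed
  \<comment> \<open>Both sides are continuous in t and agree on the rationals, which are
    dense.\<close>
  have scale: "N (t *\<^sub>R z) = \<bar>t\<bar> * N z" for t z
  proof -
    have "continuous_on UNIV (\<lambda>t. N (t *\<^sub>R z))"
      by (rule continuous_on_compose2[OF cont]) (auto intro!: continuous_intros)
    then have "closed {t. N (t *\<^sub>R z) = \<bar>t\<bar> * N z}"
      by (intro closed_Collect_eq continuous_intros)
    then have "closure \<rat> \<subseteq> {t. N (t *\<^sub>R z) = \<bar>t\<bar> * N z}"
      using rat by (intro closure_minimal) auto
    then show ?thesis unfolding Rats_closure_real by blast
  qed
  define I where "I = {z. N z < 1}"
  have "open I" unfolding I_def by (intro open_Collect_less cont continuous_intros)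
  have "closure I \<subseteq> {z. N z \<le> 1}" unfolding I_def
    by (intro closure_minimal closed_Collect_le cont continuous_intros) auto
  have comb: "N ((1 - u) *\<^sub>R x + u *\<^sub>R y) \<le> (1 - u) * N x + u * N y" if "0 \<le> u" "u \<le> 1" for u x y
    using tri[of "(1 - u) *\<^sub>R x" "u *\<^sub>R y"] that by (simp add: scale)
  have "convex I" unfolding convex_alt
  proof (intro ballI allI impI)
    fix x y u assume "x \<in> I" "y \<in> I" "0 \<le> u \<and> u \<le> (1::real)"
    then have "N x < 1" "N y < 1" "0 \<le> u" "u \<le> 1" by (auto simp: I_def)
    then show "(1 - u) *\<^sub>R x + u *\<^sub>R y \<in> I"
      using comb[of u x y] convex_bound_lt[of "N x" 1 "N y" "1 - u" u] by (simp add: I_def)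
  qed
  \<comment> \<open>Otherwise x and y have norm 1, and (1 - u) x and u y realize equality in the
    triangle inequality. Collinearity then gives y = -x, but in that case the combination has norm
    |1 - 2u| < 1.\<close>
  have strict: "N ((1 - u) *\<^sub>R x + u *\<^sub>R y) < 1"
    if xy: "N x \<le> 1" "N y \<le> 1" "x \<noteq> y" and u: "0 < u" "u < 1" for x y u
  proof (rule ccontr)
    let ?z = "(1 - u) *\<^sub>R x + u *\<^sub>R y"
    assume "\<not> N ?z < 1"
    then have ge: "1 \<le> (1 - u) * N x + u * N y" using comb[of u x y] u by simp
    have "(1 - u) * N x \<le> 1 - u" "u * N y \<le> u" using xy u by (simp_all add: mult_left_le)
    then have "(1 - u) * N x = 1 - u" "u * N y = u" using ge by linarith+
    then have one: "N x = 1" "N y = 1" using u by auto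
    then have "N ?z = 1" using \<open>\<not> N ?z < 1\<close> comb[of u x y] u by simp
    have "x \<noteq> 0" "y \<noteq> 0" using one N0(1)[of x] N0(1)[of y] by auto
    have "collinear {0, (1 - u) *\<^sub>R x, ?z}"
    proof (rule parabolic_triangle_eq_collinear[OF d])
      show "d 0 ((1 - u) *\<^sub>R x) + d ((1 - u) *\<^sub>R x) ?z = d 0 ?z"
        using \<open>N ?z = 1\<close> u by (simp add: N scale one)
    qed (use u \<open>x \<noteq> 0\<close> \<open>y \<noteq> 0\<close> in auto)
    moreover have "?z \<noteq> 0" using \<open>N ?z = 1\<close> N0(1)[of ?z] by auto
    ultimately obtain c where c: "?z = c *\<^sub>R ((1 - u) *\<^sub>R x)"
      using u \<open>x \<noteq> 0\<close> unfolding collinear_lemma by auto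
    \<comment> \<open>The factor k comes from solving the collinearity equation \<open>c\<close> for
      y.\<close>
    define k where "k = (c - 1) * (1 - u) / u"
    have "u *\<^sub>R y = ((c - 1) * (1 - u)) *\<^sub>R x" using c by (simp add: algebra_simps)
    also have "\<dots> = u *\<^sub>R (k *\<^sub>R x)" using u by (simp add: k_def)
    finally have "u *\<^sub>R y = u *\<^sub>R (k *\<^sub>R x)" .
    then have y: "y = k *\<^sub>R x" using u by (simp only: scaleR_cancel_left) simp
    then have "\<bar>k\<bar> = 1" using one by (simp add: scale)
    moreover have "k \<noteq> 1" using y xy(3) by auto
    ultimately have "k = - 1" by linarith
    then have "1 - 2 * u = (1 - u) + u * k" by simp
    then have "?z = (1 - 2 * u) *\<^sub>R x" using y by (simp only: scaleR_add_left scaleR_scaleR)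
    then show False using \<open>N ?z = 1\<close> u by (simp add: scale one abs_if split: if_splits)
  qed
  have "strictly_convex I" unfolding strictly_convex_def interior_open[OF \<open>open I\<close>]
  proof (intro ballI impI subsetI)
    fix x y z assume "x \<in> closure I" "y \<in> closure I" "x \<noteq> y" "z \<in> open_segment x y"
    then show "z \<in> I" using strict[of x y] \<open>closure I \<subseteq> {z. N z \<le> 1}\<close>
      by (auto simp: in_segment I_def)
  qed
  \<comment> \<open>By compactness \<open>N\<close> has a positive minimum on the Euclidean unit
    sphere, and by homogeneity its reciprocal bounds \<open>I\<close>.\<close>
  moreover have "bounded I"
  proof -
    obtain b :: 'a where b: "norm b = 1" using nonempty_Basis norm_Basis by blast
    then have "sphere (0 :: 'a) 1 \<noteq> {}" by (metis empty_iff mem_sphere_0)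
    then obtain s where s: "s \<in> sphere 0 1" "\<And>z. z \<in> sphere 0 1 \<Longrightarrow> N s \<le> N z"
      using continuous_attains_inf[OF compact_sphere _ contS] by metis
    then have "N s > 0" using N0[of s] by (auto simp: less_le)
    have "norm z \<le> 1 / N s" if "z \<in> I" for z
    proof (cases "z = 0")
      case False
      then have "N s \<le> N (z /\<^sub>R norm z)" by (intro s(2)) simp
      then have "N s * norm z \<le> N z" using False by (simp add: scale field_simps)
      then show ?thesis using that \<open>N s > 0\<close> by (simp add: I_def field_simps)
    qed (use \<open>N s > 0\<close> in simp)
    then show ?thesis unfolding bounded_iff by blast
  qed
  moreover have "0 \<in> I" using N0(1)[of 0] by (simp add: I_def)
  ultimately have "minkowski_indicatrix I"
    unfolding minkowski_indicatrix_def using \<open>open I\<close> convex_connected[OF \<open>convex I\<close>]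
    by (auto simp: I_def minus)
  moreover have "d x y = minkowski_dist I x y" for x y
  proof -
    \<comment> \<open>By homogeneity the admissible l form the open ray above \<open>d x y\<close>,
      which has \<open>d x y\<close> as its infimum.\<close>
    have "(y - x) /\<^sub>R l \<in> I \<longleftrightarrow> d x y < l" if "l > 0" for l
      using that unfolding I_def mem_Collect_eq scale N by (simp add: field_simps)
    then have "{l. l > 0 \<and> (y - x) /\<^sub>R l \<in> I} = {d x y<..}"
      using m(1)[of x y] by auto
    then show ?thesis by (simp add: minkowski_dist_def)
  qed
  ultimately show ?thesis unfolding minkowski_metric_def by blast
qed

theorem theorem3p1:
  fixes d :: "real ^ 'n \<Rightarrow> real ^ 'n \<Rightarrow> real"
  assumes "projective_metric_parabolic d"
  shows "((\<exists>U. open U \<and> U \<noteq> {} \<and> U \<subseteq> centers d) \<longleftrightarrow> minkowski_geometry d)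
    \<and> (CARD('n) \<ge> 2 \<longrightarrow>
        ((\<exists>U. open U \<and> U \<noteq> {} \<and> U \<subseteq> centers d) \<longleftrightarrow> minkowski_metric d))"
proof -
  have metric: "minkowski_metric d"
    if ex: "\<exists>U. open U \<and> U \<noteq> {} \<and> U \<subseteq> centers d" and card: "CARD('n) \<ge> 2"
  proof -
    obtain U where U: "open U" "U \<noteq> {}" "U \<subseteq> centers d" using ex by blast
    have "DIM(real ^ 'n) \<ge> 2" using card by simp
    from translation_invariant_if_open_centers[OF assms this U] show ?thesis
      by (rule minkowski_metric_if_translation_invariant[OF assms])
  qed
  have centers: "\<exists>U. open U \<and> U \<noteq> {} \<and> U \<subseteq> centers d" if "minkowski_geometry d"
    using centers_minkowski[OF assms that] by (intro exI[of _ UNIV]) simp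
  have "CARD('n) > 0" by (rule zero_less_card_finite)
  \<comment> \<open>In dimension 1 both sides of the first equivalence hold and the second is
    vacuous. In higher dimension an open set of centers gives the stronger
    \<open>minkowski_metric\<close>, which closes the cycle of implications.\<close>
  then consider "CARD('n) = 1" | "CARD('n) \<ge> 2" by linarith
  then show ?thesis
  proof cases
    case 1
    then have "minkowski_geometry d" by (intro minkowski_geometry_dim_1[OF assms]) simp
    then show ?thesis using centers 1 by simp
  next
    case 2
    then show ?thesis using metric centers minkowski_metric_imp_geometry[of d] by blast
  qed
qed

end
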